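(* Every normal topological space is countably normal, but the converse is not true in general: there exists a countably normal topological space which is not normal.
   Context: A topological space $X$ is called countably normal if there exist a normal space $Y$ and a bijective function $f:X\longrightarrow Y$ such that the restriction $f|_C:C\longrightarrow f(C)$ is a homeomorphism for each countable subspace $C\subseteq X$ (with $C$ and $f(C)$ carrying the subspace topologies). A space is normal if any two disjoint closed subsets can be separated by disjoint open sets; normality does not include the $T_1$ axiom. *)

theory Defs
  imports "HOL-Analysis.Analysis"
begin

text \<open>
  The witness space \<open>Y\<close> is taken over the same type as \<open>X\<close>. Since \<open>Y\<close> is in bijection with \<open>X\<close>,
  this loses no generality: see \<open>countably_normalI\<close> below, where \<open>Y\<close> lives over an arbitrary type.
  Note that \<open>normal_space\<close> does not include the \<open>T\<^sub>1\<close> axiom and that \<open>countable\<close> includes finite sets.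
\<close>

definition countably_normal :: "'a topology \<Rightarrow> bool" where
  "countably_normal X \<longleftrightarrow>
    (\<exists>(Y :: 'a topology) f. normal_space Y \<and> bij_betw f (topspace X) (topspace Y) \<and>
      (\<forall>C. C \<subseteq> topspace X \<and> countable C \<longrightarrow>
        homeomorphic_map (subtopology X C) (subtopology Y (f ` C)) f))"

lemma countably_normalI:
  fixes X :: "'a topology" and Y :: "'b topology"
  assumes Y: "normal_space Y" and f: "bij_betw f (topspace X) (topspace Y)"
    and C: "\<And>C. C \<subseteq> topspace X \<Longrightarrow> countable C \<Longrightarrow>
              homeomorphic_map (subtopology X C) (subtopology Y (f ` C)) f"
  shows "countably_normal X"
proof -
  define Z where "Z = pullback_topology (topspace X) f Y"
  have tZ: "topspace Z = topspace X"
    using f unfolding Z_def topspace_pullback_topology bij_betw_def by auto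
  have inj: "inj_on f (topspace X)" and im: "f ` topspace X = topspace Y"
    using f by (auto simp: bij_betw_def)
  have hom: "homeomorphic_map Z Y f"
  proof (rule bijective_open_imp_homeomorphic_map)
    show "continuous_map Z Y f"
      using continuous_map_pullback[OF continuous_map_id, of "topspace X" f Y]
      by (simp add: Z_def)
    show "open_map Z Y f"
      unfolding open_map_def
    proof (intro allI impI)
      fix U assume "openin Z U"
      then obtain V where V: "openin Y V" "U = f -` V \<inter> topspace X"
        by (auto simp: Z_def openin_pullback_topology)
      have "V \<subseteq> f ` topspace X"
        using openin_subset[OF V(1)] im by simp
      then have "f ` U = V"
        using V(2) by auto
      then show "openin Y (f ` U)"
        using V(1) by simp
    qed
  qed (use inj im tZ in auto)
  have "normal_space Z"
    using homeomorphic_normal_space[OF homeomorphic_map_imp_homeomorphic_space[OF hom]] Y by simp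
  moreover have "bij_betw id (topspace X) (topspace Z)"
    by (simp add: tZ)
  moreover have "homeomorphic_map (subtopology X C) (subtopology Z (id ` C)) id"
    if sub: "C \<subseteq> topspace X" and "countable C" for C
  proof -
    have "homeomorphic_map (subtopology Z C) (subtopology Y (f ` C)) f"
      using sub tZ im by (intro homeomorphic_map_subtopologies[OF hom]) blast
    then obtain g where g: "homeomorphic_maps (subtopology Z C) (subtopology Y (f ` C)) f g"
      by (auto simp: homeomorphic_map_maps)
    then have g': "homeomorphic_map (subtopology Y (f ` C)) (subtopology Z C) g"
      by (simp add: homeomorphic_maps_map)
    have "homeomorphic_map (subtopology X C) (subtopology Z C) (g \<circ> f)"
      using homeomorphic_map_compose[OF C[OF that] g'] .
    moreover have "(g \<circ> f) x = id x" if "x \<in> topspace (subtopology X C)" for x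
      using g that tZ by (auto simp: homeomorphic_maps_def)
    ultimately have "homeomorphic_map (subtopology X C) (subtopology Z C) id"
      by (rule homeomorphic_map_eq)
    then show ?thesis
      by simp
  qed
  ultimately show ?thesis
    unfolding countably_normal_def by blast
qed

end

theory Submission
  imports Defs
begin

text \<open>
  A normal space is its own witness, via the identity. For the converse, countable subspaces of the
  cocountable topology are discrete, because deleting any countable set leaves an open set; so
  the identity into the (normal) discrete space shows that this topology is countably normal. On an
  uncountable type, however, two nonempty open sets have countable complements and must therefore
  meet, so not even two distinct points, which are closed, can be separated.
\<close>

definition cocountable_topology :: "'a topology" where
  "cocountable_topology = topology (\<lambda>U. U = {} \<or> countable (- U))"

lemma openin_cocountable_topology:
  "openin cocountable_topology U \<longleftrightarrow> U = {} \<or> countable (- U)"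
proof -
  have "countable (- \<Union>\<K>)" if opens: "\<forall>K\<in>\<K>. K = {} \<or> countable (- K)" and ne: "\<Union>\<K> \<noteq> {}" for \<K> :: "'a set set"
  proof -
    obtain K where K: "K \<in> \<K>" "K \<noteq> {}"
      using ne by auto
    then have "countable (- K)"
      using opens by auto
    then show ?thesis
      by (rule countable_subset[rotated]) (use K in auto)
  qed
  then have "\<forall>\<K>. (\<forall>K\<in>\<K>. K = {} \<or> countable (- K)) \<longrightarrow>
      \<Union>\<K> = {} \<or> countable (- \<Union>\<K> :: 'a set)"
    by blast
  moreover have "\<forall>S T :: 'a set. S = {} \<or> countable (- S) \<longrightarrow> T = {} \<or> countable (- T) \<longrightarrow>
      S \<inter> T = {} \<or> countable (- (S \<inter> T))"
    by (auto simp: Compl_Int)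
  ultimately have "istopology (\<lambda>U :: 'a set. U = {} \<or> countable (- U))"
    unfolding istopology_def by blast
  then show ?thesis
    by (simp add: cocountable_topology_def topology_inverse')
qed

lemma topspace_cocountable_topology [simp]: "topspace cocountable_topology = UNIV"
  using openin_subset[of cocountable_topology UNIV] by (auto simp: openin_cocountable_topology)

lemma closedin_cocountable_topology_countable:
  "countable A \<Longrightarrow> closedin cocountable_topology A"
  by (simp add: closedin_def openin_cocountable_topology Compl_eq_Diff_UNIV[symmetric])

lemma subtopology_cocountable_topology_countable:
  assumes "countable C"
  shows "subtopology cocountable_topology C = discrete_topology C"
proof -
  have "openin (subtopology cocountable_topology C) S" if "S \<subseteq> C" for S
  proof -
    have "openin cocountable_topology (- (C - S))"
      using assms by (simp add: openin_cocountable_topology)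
    moreover have "S = - (C - S) \<inter> C"
      using that by auto
    ultimately show ?thesis
      unfolding openin_subtopology by blast
  qed
  then have "discrete_topology C = subtopology cocountable_topology C"
    unfolding discrete_topology_unique by (auto simp: subset_iff)
  then show ?thesis ..
qed

lemma countably_normal_cocountable_topology: "countably_normal cocountable_topology"
proof (rule countably_normalI)
  show "normal_space (discrete_topology UNIV)"
    by (simp add: normal_space_discrete_topology)
  show "bij_betw id (topspace cocountable_topology) (topspace (discrete_topology UNIV))"
    by simp
  show "homeomorphic_map (subtopology cocountable_topology C)
          (subtopology (discrete_topology UNIV) (id ` C)) id" if "countable C" for C :: "'a set"
    using that by (simp add: subtopology_cocountable_topology_countable)
qed

lemma not_normal_space_cocountable_topology:
  assumes "uncountable (UNIV :: 'a set)"
  shows "\<not> normal_space (cocountable_topology :: 'a topology)"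
proof
  assume normal: "normal_space (cocountable_topology :: 'a topology)"
  obtain x y :: 'a where "x \<noteq> y"
  proof -
    have "(UNIV :: 'a set) \<noteq> {undefined}"
      using assms by (metis countable_empty countable_insert)
    then show thesis
      using that by blast
  qed
  then have "disjnt {x} {y}"
    by simp
  moreover have "closedin cocountable_topology {x}" "closedin cocountable_topology {y}"
    by (simp_all add: closedin_cocountable_topology_countable)
  ultimately obtain U V where
    UV: "openin cocountable_topology U" "openin cocountable_topology V" "x \<in> U" "y \<in> V" "disjnt U V"
    using normal unfolding normal_space_def by (meson insert_subset)
  then have "countable (- U \<union> - V)"
    by (auto simp: openin_cocountable_topology)
  moreover have "- U \<union> - V = UNIV"
    using UV(5) by (auto simp: disjnt_def)
  ultimately show False
    using assms by simp
qed

theorem mainTheorem1: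
  shows "(\<forall>X :: 'a topology. normal_space X \<longrightarrow> countably_normal X) \<and>
         (\<exists>X :: real topology. countably_normal X \<and> \<not> normal_space X)"
proof (intro conjI allI impI)
  fix X :: "'a topology"
  assume "normal_space X"
  then show "countably_normal X"
    by (rule countably_normalI[where f = id]) simp_all
next
  show "\<exists>X :: real topology. countably_normal X \<and> \<not> normal_space X"
    using countably_normal_cocountable_topology
      not_normal_space_cocountable_topology[OF uncountable_UNIV_real] by blast
qed

end
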